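(* Let $\Gamma$ be a finitely generated group and let $(\Omega,\mu)$ be an ergodic standard Borel probability $\Gamma$-space. Let $\sigma_1,\sigma_2:\Gamma\times\Omega\to\mathrm{Homeo}^+(\mathbb{S}^1)$ be two measurable cocycles and suppose that they are minimal. Then $\sigma_1$ is left semicohomologous to $\sigma_2$ if and only if $\sigma_1$ is cohomologous to $\sigma_2$.
   Context: A standard Borel probability $\Gamma$-space is a standard Borel probability space $(\Omega,\mu)$ with an essentially free, measure preserving action of $\Gamma$; it is ergodic if the action is. Put $H=\mathrm{Homeo}^+(\mathbb{S}^1)$, the group of orientation preserving homeomorphisms of $\mathbb{S}^1\cong\mathbb{R}/\mathbb{Z}$, with the Borel structure of the compact-open topology. A measurable cocycle is a measurable map $\sigma:\Gamma\times\Omega\to H$ with $\sigma(\gamma_1\gamma_2,\omega)=\sigma(\gamma_1,\gamma_2\omega)\sigma(\gamma_2,\omega)$ for every $\gamma_1,\gamma_2\in\Gamma$ and almost every $\omega\in\Omega$. Minimality: let $\mathcal{F}_0(\mathbb{S}^1)$ be the collection of non-empty closed subsets of $\mathbb{S}^1$ with the Borel structure coming from the Hausdorff topology. A measurable cocycle $\sigma$ is minimal if the only measurable function $\Phi:\Omega\to\mathcal{F}_0(\mathbb{S}^1)$ (up to almost everywhere equality) which is $\sigma$-equivariant, i.e. $\Phi(\gamma\omega)=\sigma(\gamma,\omega)\Phi(\omega)$ for every $\gamma\in\Gamma$ and almost every $\omega\in\Omega$, is the constant function $\Phi(\omega)=\mathbb{S}^1$. A non-decreasing degree one map $\mathbb{S}^1\to\mathbb{S}^1$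 is a (not necessarily continuous) map that weakly preserves the cyclic order of every $k$-tuple of points, for every $k\in\mathbb{N}$; equivalently, it has a lift $\mathbb{R}\to\mathbb{R}$ that is non-decreasing and commutes with integer translations (constant maps are allowed). $\sigma_1$ is left semicohomologous to $\sigma_2$ if there is a measurable map $\varphi:\mathbb{S}^1\times\Omega\to\mathbb{S}^1$ such that $\varphi(\omega):=\varphi(\cdot,\omega)$ is a non-decreasing degree one map for almost every $\omega$ and $\sigma_1(\gamma,\omega)\varphi(\omega)=\varphi(\gamma\omega)\sigma_2(\gamma,\omega)$ for every $\gamma\in\Gamma$ and almost every $\omega\in\Omega$. $\sigma_1$ and $\sigma_2$ are cohomologous if there is such a $\varphi$ with moreover $\varphi(\omega)\in H$ for almost every $\omega\in\Omega$. *)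

theory Defs
  imports "HOL-Probability.Probability" "HOL-Algebra.Group_Action" "HOL-Algebra.Generated_Groups"
begin

section \<open>The circle\<close>

quotient_type circle = real / "\<lambda>x y :: real. x - y \<in> \<int>"
proof (rule equivpI)
  show "symp (\<lambda>x y :: real. x - y \<in> \<int>)"
  proof (rule sympI)
    fix x y :: real assume "x - y \<in> \<int>"
    from Ints_minus[OF this] show "y - x \<in> \<int>" by simp
  qed
  show "transp (\<lambda>x y :: real. x - y \<in> \<int>)"
  proof (rule transpI)
    fix x y z :: real assume "x - y \<in> \<int>" "y - z \<in> \<int>"
    from Ints_add[OF this] show "x - z \<in> \<int>" by simp
  qed
qed (simp add: reflp_def)

lift_definition to_circle :: "real \<Rightarrow> circle" is "\<lambda>x. x" .

lemma to_circle_eq_iff: "to_circle x = to_circle y \<longleftrightarrow> x - y \<in> \<int>"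
  by transfer simp

lemma to_circle_cases: obtains x where "p = to_circle x"
proof -
  have "p = to_circle (rep_circle p)"
    by (simp add: to_circle_def Quotient3_abs_rep[OF Quotient3_circle])
  then show ?thesis by (rule that)
qed

lemma to_circle_add_int [simp]: "to_circle (x + of_int n) = to_circle x"
  by (simp add: to_circle_eq_iff)

lemma to_circle_add_1 [simp]: "to_circle (x + 1) = to_circle x"
  by (simp add: to_circle_eq_iff)

lemma to_circle_rep: obtains y where "p = to_circle y" "c \<le> y" "y < c + 1"
proof -
  obtain x where x: "p = to_circle x" by (rule to_circle_cases)
  define y where "y = x + of_int (- \<lfloor>x - c\<rfloor>)"
  have "p = to_circle y" unfolding y_def x by (simp only: to_circle_add_int)
  moreover have "c \<le> y" "y < c + 1"
    unfolding y_def using of_int_floor_le[of "x - c"] floor_correct[of "x - c"]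
    unfolding of_int_minus of_int_add of_int_1 by linarith+
  ultimately show ?thesis using that by blast
qed

lemma to_circle_eq_unique:
  assumes "to_circle x = to_circle y" "c \<le> x" "x < c + 1" "c \<le> y" "y < c + 1"
  shows "x = y"
proof -
  obtain n :: int where n: "x - y = of_int n"
    using assms(1) by (auto simp: to_circle_eq_iff elim: Ints_cases)
  have "\<bar>real_of_int n\<bar> < 1" using n assms by linarith
  then have "n = 0" by linarith
  then show ?thesis using n by simp
qed

instantiation circle :: metric_space
begin

definition dist_circle :: "circle \<Rightarrow> circle \<Rightarrow> real" where
  "dist_circle p q = (INF (x, y) \<in> {(x, y). to_circle x = p \<and> to_circle y = q}. \<bar>x - y\<bar>)"

definition uniformity_circle :: "(circle \<times> circle) filter" where
  "uniformity_circle = (INF e\<in>{0<..}. principal {(x, y). dist x y < e})"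

definition open_circle :: "circle set \<Rightarrow> bool" where
  "open_circle U \<longleftrightarrow> (\<forall>x\<in>U. eventually (\<lambda>(x', y). x' = x \<longrightarrow> y \<in> U) uniformity)"

lemma dist_circle_le: "dist (to_circle x) (to_circle y) \<le> \<bar>x - y\<bar>"
proof -
  let ?S = "{(x', y'). to_circle x' = to_circle x \<and> to_circle y' = to_circle y}"
  have "bdd_below ((\<lambda>(x, y). \<bar>x - y\<bar>) ` ?S)" by (rule bdd_belowI[of _ 0]) auto
  then have "dist (to_circle x) (to_circle y) \<le> (case (x, y) of (x, y) \<Rightarrow> \<bar>x - y\<bar>)"
    unfolding dist_circle_def by (rule cINF_lower) auto
  then show ?thesis by simp
qed

lemma dist_circle_lessE:
  assumes "dist (to_circle x) q < e"
  obtains y where "q = to_circle y" "\<bar>x - y\<bar> < e"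
proof -
  let ?S = "{(x', y'). to_circle x' = to_circle x \<and> to_circle y' = q}"
  obtain y0 where "q = to_circle y0" by (rule to_circle_cases)
  then have ne: "?S \<noteq> {}" by auto
  have bdd: "bdd_below ((\<lambda>(x, y). \<bar>x - y\<bar>) ` ?S)" by (rule bdd_belowI[of _ 0]) auto
  obtain x' y' where xy: "to_circle x' = to_circle x" "to_circle y' = q" "\<bar>x' - y'\<bar> < e"
    using assms unfolding dist_circle_def cINF_less_iff[OF ne bdd] by auto
  obtain n :: int where n: "x' - x = of_int n"
    using xy(1) by (auto simp: to_circle_eq_iff elim: Ints_cases)
  have "q = to_circle (y' + of_int (- n))" using xy(2) by (simp only: to_circle_add_int)
  moreover have "\<bar>x - (y' + of_int (- n))\<bar> < e" using xy(3) n by simp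
  ultimately show ?thesis using that by blast
qed

lemma dist_circle_nonneg: "0 \<le> dist (p :: circle) q"
proof -
  obtain x y where "p = to_circle x" "q = to_circle y" by (metis to_circle_cases)
  then show ?thesis unfolding dist_circle_def by (intro cINF_greatest) auto
qed

instance
proof
  fix p q r :: circle
  obtain x where x: "p = to_circle x" by (rule to_circle_cases)
  show "dist p q = 0 \<longleftrightarrow> p = q"
  proof
    assume "p = q"
    then show "dist p q = 0"
      using dist_circle_le[of x x] dist_circle_nonneg[of p p] x by simp
  next
    assume *: "dist p q = 0"
    obtain y0 where y0: "q = to_circle y0" "x \<le> y0" "y0 < x + 1"
      by (rule to_circle_rep[of q x])
    show "p = q"
    proof (rule ccontr)
      assume "p \<noteq> q"
      then have "y0 \<noteq> x" using x y0 by auto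
      define e where "e = min (y0 - x) (x + 1 - y0)"
      have "e > 0" using \<open>y0 \<noteq> x\<close> y0 by (auto simp: e_def)
      then obtain y where y: "q = to_circle y" "\<bar>x - y\<bar> < e"
        using dist_circle_lessE[of x q e] * x by auto
      show False
      proof (cases "y \<ge> x")
        case True
        then have "y = y0"
          using y y0 by (intro to_circle_eq_unique[of _ _ x]) (auto simp: e_def)
        then show False using y by (auto simp: e_def)
      next
        case False
        have "y + 1 = y0"
          using y y0 False by (intro to_circle_eq_unique[of _ _ x]) (auto simp: e_def)
        then show False using y by (auto simp: e_def)
      qed
    qed
  qed
  show "dist p q \<le> dist p r + dist q r"
  proof (rule field_le_epsilon)
    fix e :: real assume e: "e > 0"
    obtain z where z: "r = to_circle z" by (rule to_circle_cases)
    have comm: "dist a b \<le> dist b a" for a b :: circle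
    proof (rule field_le_epsilon)
      fix e :: real assume "e > 0"
      obtain u where u: "b = to_circle u" by (rule to_circle_cases)
      obtain v where v: "a = to_circle v" "\<bar>u - v\<bar> < dist b a + e"
        using dist_circle_lessE[of u a "dist b a + e"] u \<open>e > 0\<close> by auto
      show "dist a b \<le> dist b a + e" using dist_circle_le[of v u] u v by simp
    qed
    obtain y where y: "p = to_circle y" "\<bar>z - y\<bar> < dist r p + e / 2"
      using dist_circle_lessE[of z p "dist r p + e / 2"] z e by auto
    obtain w where w: "q = to_circle w" "\<bar>z - w\<bar> < dist r q + e / 2"
      using dist_circle_lessE[of z q "dist r q + e / 2"] z e by auto
    have "dist p q \<le> \<bar>y - w\<bar>" using dist_circle_le y w by simp
    also have "\<dots> \<le> dist r p + dist r q + e" using y w by simp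
    also have "\<dots> \<le> dist p r + dist q r + e" using comm[of r p] comm[of r q] by simp
    finally show "dist p q \<le> dist p r + dist q r + e" .
  qed
qed (rule uniformity_circle_def open_circle_def)+

end

lemma dist_circle_bounded: "dist (p :: circle) q \<le> 1"
proof -
  obtain x where x: "p = to_circle x" by (rule to_circle_cases)
  obtain y where y: "q = to_circle y" "x \<le> y" "y < x + 1" by (rule to_circle_rep[of q x])
  show ?thesis using dist_circle_le[of x y] x y by simp
qed

lemma open_circle_iff_quotient: "open U \<longleftrightarrow> open (to_circle -` U)"
proof
  assume U: "open U"
  show "open (to_circle -` U)"
    unfolding open_dist
  proof
    fix x assume "x \<in> to_circle -` U"
    then obtain e where e: "e > 0" "\<And>q. dist q (to_circle x) < e \<Longrightarrow> q \<in> U"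
      using U unfolding open_dist by auto
    show "\<exists>e>0. \<forall>y. dist y x < e \<longrightarrow> y \<in> to_circle -` U"
    proof (intro exI[of _ e] conjI allI impI)
      fix y assume "dist y x < e"
      then show "y \<in> to_circle -` U"
        using e(2)[of "to_circle y"] dist_circle_le[of y x] by (simp add: dist_real_def)
    qed fact
  qed
next
  assume U: "open (to_circle -` U)"
  show "open U"
    unfolding open_dist
  proof
    fix p assume p: "p \<in> U"
    obtain x where x: "p = to_circle x" by (rule to_circle_cases)
    obtain e where e: "e > 0" "\<And>y. dist y x < e \<Longrightarrow> to_circle y \<in> U"
      using U p x unfolding open_dist by auto
    show "\<exists>e>0. \<forall>q. dist q p < e \<longrightarrow> q \<in> U"
    proof (intro exI[of _ e] conjI allI impI)
      fix q assume "dist q p < e"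
      then obtain y where "q = to_circle y" "\<bar>x - y\<bar> < e"
        using dist_circle_lessE[of x q e] x by (metis dist_commute)
      then show "q \<in> U" using e(2)[of y] by (simp add: dist_real_def abs_minus_commute)
    qed fact
  qed
qed


section \<open>Non-decreasing degree one maps\<close>

text \<open>Repetitions are allowed, and the tuple may end at its starting point after a full turn.\<close>

definition weakly_cyclically_ordered :: "circle list \<Rightarrow> bool" where
  "weakly_cyclically_ordered ps \<longleftrightarrow>
     (\<exists>ts. ps = map to_circle ts \<and> sorted ts \<and> (ts \<noteq> [] \<longrightarrow> last ts \<le> hd ts + 1))"

definition nondecreasing_degree_one :: "(circle \<Rightarrow> circle) \<Rightarrow> bool" where
  "nondecreasing_degree_one f \<longleftrightarrow>
     (\<forall>ps. weakly_cyclically_ordered ps \<longrightarrow> weakly_cyclically_ordered (map f ps))"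

definition is_circle_lift :: "(real \<Rightarrow> real) \<Rightarrow> (circle \<Rightarrow> circle) \<Rightarrow> bool" where
  "is_circle_lift F f \<longleftrightarrow>
     (\<forall>x. F (x + 1) = F x + 1) \<and> (\<forall>x. f (to_circle x) = to_circle (F x))"

lemma weakly_cyclically_ordered_ConsE:
  assumes "weakly_cyclically_ordered (to_circle c # ps)"
  obtains ts where "ps = map to_circle ts" "sorted ts" "\<forall>t\<in>set ts. c \<le> t \<and> t \<le> c + 1"
proof -
  obtain ts where ts: "to_circle c # ps = map to_circle ts" "sorted ts"
      "ts \<noteq> [] \<longrightarrow> last ts \<le> hd ts + 1"
    using assms unfolding weakly_cyclically_ordered_def by (elim exE conjE)
  obtain t us where "ts = t # us" using ts(1) by (cases ts) simp_all
  then have tus: "to_circle c = to_circle t" "ps = map to_circle us" "sorted (t # us)"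
      "last (t # us) \<le> t + 1"
    using ts by simp_all
  obtain n :: int where n: "c - t = of_int n"
    using tus(1) by (auto simp: to_circle_eq_iff elim: Ints_cases)
  have le: "u \<le> t + 1" if "u \<in> set us" for u
  proof -
    have "sorted us" using tus(3) by simp
    then have "u \<le> last us" using that by (induction us) auto
    then show ?thesis using that tus(4) by (auto split: if_splits)
  qed
  show ?thesis
  proof (rule that[of "map (\<lambda>u. u + of_int n) us"])
    show "ps = map to_circle (map (\<lambda>u. u + of_int n) us)"
      unfolding tus(2) by simp
    show "sorted (map (\<lambda>u. u + of_int n) us)"
      using tus(3) by (simp add: sorted_map)
    show "\<forall>t\<in>set (map (\<lambda>u. u + real_of_int n) us). c \<le> t \<and> t \<le> c + 1"
      using tus(3) le n by fastforce
  qed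
qed

lemma nondecreasing_degree_one_iff_lift:
  "nondecreasing_degree_one f \<longleftrightarrow> (\<exists>F. mono F \<and> is_circle_lift F f)"
proof
  assume "\<exists>F. mono F \<and> is_circle_lift F f"
  then obtain F where F: "mono F" "\<And>x. F (x + 1) = F x + 1"
      "\<And>x. f (to_circle x) = to_circle (F x)"
    unfolding is_circle_lift_def by auto
  show "nondecreasing_degree_one f"
    unfolding nondecreasing_degree_one_def
  proof (intro allI impI)
    fix ps assume "weakly_cyclically_ordered ps"
    then obtain ts where ts: "ps = map to_circle ts" "sorted ts"
        "ts \<noteq> [] \<longrightarrow> last ts \<le> hd ts + 1"
      unfolding weakly_cyclically_ordered_def by auto
    show "weakly_cyclically_ordered (map f ps)"
      unfolding weakly_cyclically_ordered_def
    proof (intro exI[of _ "map F ts"] conjI impI)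
      show "map f ps = map to_circle (map F ts)" using ts(1) F(3) by simp
      show "sorted (map F ts)" using ts(2) monoD[OF F(1)]
        by (simp add: sorted_iff_nth_mono)
      assume "map F ts \<noteq> []"
      then have ne: "ts \<noteq> []" by simp
      have "F (last ts) \<le> F (hd ts + 1)" using ts(3) ne F(1) by (auto dest: monoD)
      then show "last (map F ts) \<le> hd (map F ts) + 1"
        using ne F(2) by (simp add: last_map hd_map)
    qed
  qed
next
  assume f: "nondecreasing_degree_one f"
  obtain c where c: "f (to_circle 0) = to_circle c" by (rule to_circle_cases)
  have "\<exists>y. f (to_circle x) = to_circle y \<and> c \<le> y \<and> y < c + 1" for x
    by (rule to_circle_rep[of "f (to_circle x)" c]) blast
  then obtain g where g: "\<And>x. f (to_circle x) = to_circle (g x)" "\<And>x. c \<le> g x"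
      "\<And>x. g x < c + 1"
    by metis
  have lifts: "\<exists>us. map to_circle us = map (\<lambda>x. to_circle (g x)) xs \<and> sorted us \<and>
      (\<forall>u\<in>set us. c \<le> u \<and> u \<le> c + 1)"
    if "sorted xs" "\<forall>x\<in>set xs. 0 \<le> x \<and> x < 1" for xs
  proof -
    have "weakly_cyclically_ordered (map to_circle (0 # xs))"
      unfolding weakly_cyclically_ordered_def
    proof (intro exI[of _ "0 # xs"] conjI impI refl)
      show "sorted (0 # xs)" using that by simp
      have "xs \<noteq> [] \<Longrightarrow> last xs \<le> 1"
        using that(2) last_in_set[of xs] by (meson less_imp_le)
      then show "last (0 # xs) \<le> hd (0 # xs) + 1" by simp
    qed
    then have "weakly_cyclically_ordered (map f (map to_circle (0 # xs)))"
      using f unfolding nondecreasing_degree_one_def by blast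
    then have "weakly_cyclically_ordered (to_circle c # map (\<lambda>x. to_circle (g x)) xs)"
      using g(1) c by (simp add: comp_def)
    then show ?thesis by (rule weakly_cyclically_ordered_ConsE) metis
  qed
  have uq: "u = g x" if "to_circle u = to_circle (g x)" "c \<le> u" "u \<le> c + 1" "u \<noteq> c + 1" for u x
    using that g by (intro to_circle_eq_unique[of _ _ c]) auto
  have uq_c: "g x = c" if "to_circle (c + 1) = to_circle (g x)" for x
    using that g by (intro to_circle_eq_unique[of _ _ c]) auto
  have two: "g x \<le> g y" if H: "0 \<le> x" "x \<le> y" "y < 1" "g y \<noteq> c" for x y
  proof -
    obtain s t where st: "to_circle s = to_circle (g x)" "to_circle t = to_circle (g y)"
        "s \<le> t" "c \<le> s" "t \<le> c + 1"
    proof -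
      have sx: "sorted [x, y]" "\<forall>z\<in>set [x, y]. 0 \<le> z \<and> z < 1"
        using H(1-3) by auto
      obtain us where us: "map to_circle us = map (\<lambda>x. to_circle (g x)) [x, y]" "sorted us"
          "\<forall>u\<in>set us. c \<le> u \<and> u \<le> c + 1"
        using lifts[OF sx] by blast
      obtain s t where "us = [s, t]" using us(1) by (auto simp: map_eq_Cons_conv)
      then show thesis using us by (intro that[of s t]) auto
    qed
    have "t \<noteq> c + 1" using st uq_c H by auto
    then have "t = g y" using st uq[of t y] by auto
    moreover have "s = g x" using st uq[of s x] \<open>t \<noteq> c + 1\<close> by auto
    ultimately show ?thesis using st by simp
  qed
  have three: False if H: "0 \<le> a" "a \<le> x" "x \<le> y" "y < 1" "g a \<noteq> c" "g x = c" "g y \<noteq> c" for a x y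
  proof -
    obtain r s t where st: "to_circle r = to_circle (g a)" "to_circle s = to_circle (g x)"
        "to_circle t = to_circle (g y)" "r \<le> s" "s \<le> t" "c \<le> r" "t \<le> c + 1"
    proof -
      have sx: "sorted [a, x, y]" "\<forall>z\<in>set [a, x, y]. 0 \<le> z \<and> z < 1"
        using H(1-4) by auto
      obtain us where us: "map to_circle us = map (\<lambda>x. to_circle (g x)) [a, x, y]" "sorted us"
          "\<forall>u\<in>set us. c \<le> u \<and> u \<le> c + 1"
        using lifts[OF sx] by blast
      obtain r s t where "us = [r, s, t]" using us(1) by (auto simp: map_eq_Cons_conv)
      then show thesis using us by (intro that[of r s t]) auto
    qed
    have t: "t \<noteq> c + 1" using st uq_c H by auto
    then have "s = g x" using st uq[of s x] by auto
    moreover have "r = g a" using st t uq[of r a] by auto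
    ultimately show False using st H g(2)[of a] by auto
  qed
  define F0 where "F0 x = (if g x = c \<and> (\<exists>a. 0 \<le> a \<and> a < x \<and> g a \<noteq> c) then c + 1 else g x)" for x
  have F0_bounds: "c \<le> F0 x" "F0 x \<le> c + 1" for x
    using g(2,3)[of x] by (auto simp: F0_def)
  have F0_lift: "to_circle (F0 x) = f (to_circle x)" for x
    using g(1) by (auto simp: F0_def)
  have F0_mono: "F0 x \<le> F0 y" if "0 \<le> x" "x < y" "y < 1" for x y
  proof (cases "g y = c")
    case True
    show ?thesis
    proof (cases "\<exists>a. 0 \<le> a \<and> a < y \<and> g a \<noteq> c")
      case True
      then have "F0 y = c + 1" using \<open>g y = c\<close> by (simp add: F0_def)
      then show ?thesis using F0_bounds by simp
    next
      case False
      then have "g x = c" "\<not> (\<exists>a. 0 \<le> a \<and> a < x \<and> g a \<noteq> c)"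
        using that less_trans[OF _ that(2)] by blast+
      then have "F0 x = c" unfolding F0_def by argo
      then show ?thesis using F0_bounds by simp
    qed
  next
    case False
    then have y: "F0 y = g y" by (simp add: F0_def)
    have "\<not> (g x = c \<and> (\<exists>a. 0 \<le> a \<and> a < x \<and> g a \<noteq> c))"
      using three[OF _ less_imp_le less_imp_le[OF that(2)] that(3) _ _ False] by blast
    then have "F0 x = g x" unfolding F0_def by (rule if_not_P)
    then show ?thesis using y two[of x y] False that by simp
  qed
  define F where "F x = F0 (frac x) + of_int \<lfloor>x\<rfloor>" for x
  have "mono F"
  proof
    fix x y :: real assume "x \<le> y"
    show "F x \<le> F y"
    proof (cases "\<lfloor>x\<rfloor> = \<lfloor>y\<rfloor>")
      case True
      then have "frac x \<le> frac y" using \<open>x \<le> y\<close> by (simp add: frac_def)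
      then have "F0 (frac x) \<le> F0 (frac y)"
        using F0_mono[of "frac x" "frac y"] frac_lt_1[of y] frac_ge_0[of x]
        by (cases "frac x = frac y") auto
      then show ?thesis using True by (simp add: F_def)
    next
      case False
      then have "\<lfloor>x\<rfloor> + 1 \<le> \<lfloor>y\<rfloor>" using floor_mono[OF \<open>x \<le> y\<close>] by linarith
      then have "real_of_int \<lfloor>x\<rfloor> + 1 \<le> real_of_int \<lfloor>y\<rfloor>" by linarith
      then show ?thesis
        using F0_bounds(2)[of "frac x"] F0_bounds(1)[of "frac y"] by (simp add: F_def)
    qed
  qed
  moreover have "is_circle_lift F f"
    unfolding is_circle_lift_def
  proof (intro conjI allI)
    fix x
    show "F (x + 1) = F x + 1" by (simp add: F_def frac_def)
    have "f (to_circle x) = f (to_circle (frac x + of_int \<lfloor>x\<rfloor>))" by (simp add: frac_def)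
    then show "f (to_circle x) = to_circle (F x)"
      by (simp add: F_def F0_lift)
  qed
  ultimately show "\<exists>F. mono F \<and> is_circle_lift F f" by blast
qed


section \<open>Borel structures\<close>

definition borel_of :: "'a topology \<Rightarrow> 'a measure" where
  "borel_of X = sigma (topspace X) {U. openin X U}"

definition homeo_plus :: "(circle \<Rightarrow> circle) set" where
  "homeo_plus = {f. (\<exists>g. homeomorphism UNIV UNIV f g) \<and>
                    (\<exists>F. continuous_on UNIV F \<and> strict_mono F \<and> is_circle_lift F f)}"

definition compact_open_topology :: "(circle \<Rightarrow> circle) topology" where
  "compact_open_topology =
     topology_generated_by {{f \<in> homeo_plus. f ` K \<subseteq> U} | K U. compact K \<and> open U}"

lemma topspace_compact_open [simp]: "topspace compact_open_topology = homeo_plus"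
proof -
  have "homeo_plus \<in> {{f \<in> homeo_plus. f ` K \<subseteq> U} | K U. compact K \<and> open U}"
    by (rule CollectI, rule exI[of _ "{}"], rule exI[of _ UNIV]) auto
  then show ?thesis
    unfolding compact_open_topology_def topology_generated_by_topspace by blast
qed

definition closed_nonempty :: "circle set set" where
  "closed_nonempty = {A. closed A \<and> A \<noteq> {}}"

text \<open>The value on the empty set is irrelevant; it only keeps the distance non-negative everywhere.\<close>

definition hausdorff_dist :: "circle set \<Rightarrow> circle set \<Rightarrow> real" where
  "hausdorff_dist A B =
     (if A = {} \<or> B = {} then 0 else max (SUP a\<in>A. infdist a B) (SUP b\<in>B. infdist b A))"

text \<open>The constant below exists without the locale assumption;
  \<open>Metric_space_hausdorff\<close> shows that it is the topology of a metric.\<close>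

definition hausdorff_topology :: "circle set topology" where
  "hausdorff_topology = Metric_space.mtopology closed_nonempty hausdorff_dist"

lemma infdist_circle_le_1: "infdist p (A :: circle set) \<le> 1"
proof (cases "A = {}")
  case False
  then obtain a where "a \<in> A" by blast
  then show ?thesis using infdist_le[of a A p] dist_circle_bounded[of p a] by simp
qed (simp add: infdist_def)

lemma hausdorff_dist_le_iff:
  assumes "A \<noteq> {}" "B \<noteq> {}"
  shows "hausdorff_dist A B \<le> r \<longleftrightarrow> (\<forall>a\<in>A. infdist a B \<le> r) \<and> (\<forall>b\<in>B. infdist b A \<le> r)"
proof -
  have bdd: "bdd_above ((\<lambda>a. infdist a Y) ` X)" for X Y :: "circle set"
    by (rule bdd_aboveI[of _ 1]) (auto simp: infdist_circle_le_1)
  show ?thesis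
    unfolding hausdorff_dist_def using assms by (simp add: cSUP_le_iff[OF _ bdd])
qed

lemma hausdorff_dist_nonneg: "0 \<le> hausdorff_dist A B"
proof (cases "A = {} \<or> B = {}")
  case False
  then obtain a where "a \<in> A" by blast
  then have "infdist a B \<le> hausdorff_dist A B"
    using False hausdorff_dist_le_iff[of A B "hausdorff_dist A B"] by auto
  then show ?thesis using infdist_nonneg[of a B] by linarith
qed (simp add: hausdorff_dist_def)

lemma Metric_space_hausdorff: "Metric_space closed_nonempty hausdorff_dist"
proof
  fix A B
  show "0 \<le> hausdorff_dist A B" by (rule hausdorff_dist_nonneg)
  show "hausdorff_dist A B = hausdorff_dist B A"
    by (auto simp: hausdorff_dist_def max.commute)
next
  fix A B assume "A \<in> closed_nonempty" "B \<in> closed_nonempty"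
  then have AB: "closed A" "closed B" "A \<noteq> {}" "B \<noteq> {}" by (auto simp: closed_nonempty_def)
  have "hausdorff_dist A B = 0 \<longleftrightarrow> hausdorff_dist A B \<le> 0"
    using hausdorff_dist_nonneg[of A B] by linarith
  also have "\<dots> \<longleftrightarrow> (\<forall>a\<in>A. infdist a B = 0) \<and> (\<forall>b\<in>B. infdist b A = 0)"
    unfolding hausdorff_dist_le_iff[OF AB(3,4)] by (metis infdist_nonneg order_antisym order_refl)
  also have "\<dots> \<longleftrightarrow> A = B"
    using in_closed_iff_infdist_zero AB by blast
  finally show "hausdorff_dist A B = 0 \<longleftrightarrow> A = B" .
next
  have tri: "infdist a C \<le> infdist a B + hausdorff_dist B C" if "B \<noteq> {}" "C \<noteq> {}" for a B C
  proof -
    have "infdist a C - hausdorff_dist B C \<le> dist a b" if b: "b \<in> B" for b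
      using infdist_triangle[of a C b] b
        hausdorff_dist_le_iff[of B C "hausdorff_dist B C"] \<open>B \<noteq> {}\<close> \<open>C \<noteq> {}\<close> by force
    then have "infdist a C - hausdorff_dist B C \<le> infdist a B"
      unfolding infdist_notempty[OF \<open>B \<noteq> {}\<close>] using that by (intro cINF_greatest) auto
    then show ?thesis by simp
  qed
  fix A B C assume "A \<in> closed_nonempty" "B \<in> closed_nonempty" "C \<in> closed_nonempty"
  then have ne: "A \<noteq> {}" "B \<noteq> {}" "C \<noteq> {}" by (auto simp: closed_nonempty_def)
  have comm: "hausdorff_dist X Y = hausdorff_dist Y X" for X Y
    by (auto simp: hausdorff_dist_def max.commute)
  show "hausdorff_dist A C \<le> hausdorff_dist A B + hausdorff_dist B C"
    unfolding hausdorff_dist_le_iff[OF ne(1,3)]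
  proof (intro conjI ballI)
    fix a assume "a \<in> A"
    then have "infdist a B \<le> hausdorff_dist A B"
      using hausdorff_dist_le_iff[OF ne(1,2), of "hausdorff_dist A B"] by auto
    then show "infdist a C \<le> hausdorff_dist A B + hausdorff_dist B C"
      using tri[OF ne(2,3), of a] by linarith
  next
    fix c assume "c \<in> C"
    then have "infdist c B \<le> hausdorff_dist B C"
      using hausdorff_dist_le_iff[OF ne(2,3), of "hausdorff_dist B C"] by auto
    then show "infdist c A \<le> hausdorff_dist A B + hausdorff_dist B C"
      using tri[OF ne(2,1), of c] comm[of B A] by linarith
  qed
qed


section \<open>Groups acting on standard Borel probability spaces\<close>

definition finitely_generated_group :: "('g, 'x) monoid_scheme \<Rightarrow> bool" where
  "finitely_generated_group G \<longleftrightarrow>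
     group G \<and> (\<exists>S. finite S \<and> S \<subseteq> carrier G \<and> generate G S = carrier G)"

definition standard_borel :: "'w measure \<Rightarrow> bool" where
  "standard_borel M \<longleftrightarrow>
     (\<exists>X. completely_metrizable_space X \<and> second_countable X \<and>
          topspace X = space M \<and> sets (borel_of X) = sets M)"

text \<open>\<^locale>\<open>group_action\<close> lets the group act by elements of \<^const>\<open>BijGroup\<close>,
  i.e. bijections of \<^term>\<open>space M\<close> that are undefined outside that set.\<close>

locale standard_borel_probability_gamma_space =
  group_action \<Gamma> "space M" act + prob_space M
  for \<Gamma> :: "('g, 'x) monoid_scheme" and M :: "'w measure" and act :: "'g \<Rightarrow> 'w \<Rightarrow> 'w" +
  assumes standard_borel: "standard_borel M"
    and act_measurable: "\<And>\<gamma>. \<gamma> \<in> carrier \<Gamma> \<Longrightarrow> act \<gamma> \<in> M \<rightarrow>\<^sub>M M"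
    and act_measure_preserving: "\<And>\<gamma>. \<gamma> \<in> carrier \<Gamma> \<Longrightarrow> distr M M (act \<gamma>) = M"
    and essentially_free:
      "AE \<omega> in M. \<forall>\<gamma>\<in>carrier \<Gamma>. act \<gamma> \<omega> = \<omega> \<longrightarrow> \<gamma> = \<one>\<^bsub>\<Gamma>\<^esub>"

locale ergodic_standard_borel_probability_gamma_space =
  standard_borel_probability_gamma_space +
  assumes ergodic:
    "\<And>A. A \<in> sets M \<Longrightarrow> (\<And>\<gamma>. \<gamma> \<in> carrier \<Gamma> \<Longrightarrow> act \<gamma> -` A \<inter> space M = A) \<Longrightarrow>
         measure M A = 0 \<or> measure M A = 1"


section \<open>Cocycles\<close>

definition measurable_cocycle ::
  "('g, 'x) monoid_scheme \<Rightarrow> 'w measure \<Rightarrow> ('g \<Rightarrow> 'w \<Rightarrow> 'w) \<Rightarrow>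
   ('g \<Rightarrow> 'w \<Rightarrow> circle \<Rightarrow> circle) \<Rightarrow> bool" where
  "measurable_cocycle \<Gamma> M act \<sigma> \<longleftrightarrow>
     (\<lambda>(\<gamma>, \<omega>). \<sigma> \<gamma> \<omega>)
       \<in> count_space (carrier \<Gamma>) \<Otimes>\<^sub>M M \<rightarrow>\<^sub>M borel_of compact_open_topology \<and>
     (\<forall>\<gamma>1\<in>carrier \<Gamma>. \<forall>\<gamma>2\<in>carrier \<Gamma>. AE \<omega> in M.
        \<sigma> (\<gamma>1 \<otimes>\<^bsub>\<Gamma>\<^esub> \<gamma>2) \<omega> = \<sigma> \<gamma>1 (act \<gamma>2 \<omega>) \<circ> \<sigma> \<gamma>2 \<omega>)"

definition minimal_cocycle ::
  "('g, 'x) monoid_scheme \<Rightarrow> 'w measure \<Rightarrow> ('g \<Rightarrow> 'w \<Rightarrow> 'w) \<Rightarrow>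
   ('g \<Rightarrow> 'w \<Rightarrow> circle \<Rightarrow> circle) \<Rightarrow> bool" where
  "minimal_cocycle \<Gamma> M act \<sigma> \<longleftrightarrow>
     (\<forall>\<Phi> \<in> M \<rightarrow>\<^sub>M borel_of hausdorff_topology.
        (\<forall>\<gamma>\<in>carrier \<Gamma>. AE \<omega> in M. \<Phi> (act \<gamma> \<omega>) = \<sigma> \<gamma> \<omega> ` \<Phi> \<omega>) \<longrightarrow>
        (AE \<omega> in M. \<Phi> \<omega> = UNIV))"

definition left_semicohomology ::
  "('g, 'x) monoid_scheme \<Rightarrow> 'w measure \<Rightarrow> ('g \<Rightarrow> 'w \<Rightarrow> 'w) \<Rightarrow>
   ('g \<Rightarrow> 'w \<Rightarrow> circle \<Rightarrow> circle) \<Rightarrow> ('g \<Rightarrow> 'w \<Rightarrow> circle \<Rightarrow> circle) \<Rightarrow>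
   (circle \<times> 'w \<Rightarrow> circle) \<Rightarrow> bool" where
  "left_semicohomology \<Gamma> M act \<sigma>1 \<sigma>2 \<phi> \<longleftrightarrow>
     \<phi> \<in> borel \<Otimes>\<^sub>M M \<rightarrow>\<^sub>M borel \<and>
     (AE \<omega> in M. nondecreasing_degree_one (\<lambda>x. \<phi> (x, \<omega>))) \<and>
     (\<forall>\<gamma>\<in>carrier \<Gamma>. AE \<omega> in M.
        \<sigma>1 \<gamma> \<omega> \<circ> (\<lambda>x. \<phi> (x, \<omega>)) = (\<lambda>x. \<phi> (x, act \<gamma> \<omega>)) \<circ> \<sigma>2 \<gamma> \<omega>)"

definition left_semicohomologous ::
  "('g, 'x) monoid_scheme \<Rightarrow> 'w measure \<Rightarrow> ('g \<Rightarrow> 'w \<Rightarrow> 'w) \<Rightarrow>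
   ('g \<Rightarrow> 'w \<Rightarrow> circle \<Rightarrow> circle) \<Rightarrow> ('g \<Rightarrow> 'w \<Rightarrow> circle \<Rightarrow> circle) \<Rightarrow> bool" where
  "left_semicohomologous \<Gamma> M act \<sigma>1 \<sigma>2 \<longleftrightarrow> (\<exists>\<phi>. left_semicohomology \<Gamma> M act \<sigma>1 \<sigma>2 \<phi>)"

definition cohomologous ::
  "('g, 'x) monoid_scheme \<Rightarrow> 'w measure \<Rightarrow> ('g \<Rightarrow> 'w \<Rightarrow> 'w) \<Rightarrow>
   ('g \<Rightarrow> 'w \<Rightarrow> circle \<Rightarrow> circle) \<Rightarrow> ('g \<Rightarrow> 'w \<Rightarrow> circle \<Rightarrow> circle) \<Rightarrow> bool" where
  "cohomologous \<Gamma> M act \<sigma>1 \<sigma>2 \<longleftrightarrow>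
     (\<exists>\<phi>. left_semicohomology \<Gamma> M act \<sigma>1 \<sigma>2 \<phi> \<and> (AE \<omega> in M. (\<lambda>x. \<phi> (x, \<omega>)) \<in> homeo_plus))"

end

theory Submission
  imports Defs
begin

text \<open>
  Let \<open>\<phi>\<close> be a left semicohomology. The essential range of \<open>\<phi>(\<omega>)\<close> is a non-empty closed
  \<open>\<sigma>1\<close>-equivariant set, so by minimality of \<open>\<sigma>1\<close> it is the whole circle; a monotone lift
  with dense image has no jumps, hence \<open>\<phi>(\<omega>)\<close> is continuous. Now the set of points at which
  \<open>\<phi>(\<omega>)\<close> is not locally constant is non-empty, closed and \<open>\<sigma>2\<close>-equivariant, so by
  minimality of \<open>\<sigma>2\<close> it too is the whole circle; hence the lift is strictly increasing and
  \<open>\<phi>(\<omega>)\<close> is a homeomorphism.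
\<close>

section \<open>Topology of the circle\<close>

lemma continuous_on_to_circle: "continuous_on A to_circle"
proof (rule continuous_on_subset[OF _ subset_UNIV])
  show "continuous_on UNIV to_circle"
    by (subst continuous_on_open_vimage) (auto simp: open_circle_iff_quotient)
qed

text \<open>The distance is an infimum over pairs of representatives, and translating both by an
  integer keeps the first one at \<open>x\<close>. Openness of the projection and connectedness of
  balls follow.\<close>

lemma ball_to_circle: "ball (to_circle x) r = to_circle ` ball x r"
proof
  show "ball (to_circle x) r \<subseteq> to_circle ` ball x r"
  proof
    fix q assume "q \<in> ball (to_circle x) r"
    then obtain y where "q = to_circle y" "\<bar>x - y\<bar> < r"
      by (auto elim: dist_circle_lessE)
    then show "q \<in> to_circle ` ball x r" by (auto simp: dist_real_def)
  qed
  show "to_circle ` ball x r \<subseteq> ball (to_circle x) r"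
    by (auto simp: dist_real_def intro: le_less_trans[OF dist_circle_le])
qed

lemma open_to_circle_image:
  assumes "open A"
  shows "open (to_circle ` A)"
  unfolding open_contains_ball
proof
  fix p assume "p \<in> to_circle ` A"
  then obtain x where x: "p = to_circle x" "x \<in> A" by auto
  obtain e where "e > 0" "ball x e \<subseteq> A" using assms x(2) open_contains_ball by blast
  then show "\<exists>e>0. ball p e \<subseteq> to_circle ` A"
    unfolding x(1) ball_to_circle by blast
qed

lemma connected_ball_circle: "connected (ball (p :: circle) r)"
proof -
  obtain x where x: "p = to_circle x" by (rule to_circle_cases)
  show ?thesis unfolding x ball_to_circle
    by (intro connected_continuous_image continuous_on_to_circle) auto
qed

lemma range_to_circle: "range to_circle = UNIV"
  by (auto intro: to_circle_cases)

lemma compact_circle: "compact (UNIV :: circle set)"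
proof -
  have "p \<in> to_circle ` {0..1}" for p
    by (rule to_circle_rep[of p 0]) auto
  then have "UNIV = to_circle ` {0..1}" by auto
  then show ?thesis by (metis compact_Icc compact_continuous_image continuous_on_to_circle)
qed

lemma connected_circle: "connected (UNIV :: circle set)"
  using connected_continuous_image[OF continuous_on_to_circle connected_UNIV]
  unfolding range_to_circle .

text \<open>Supplies the countable dense set of test points on which the measurability arguments
  rest.\<close>

lemma closure_to_circle_Rats: "closure (to_circle ` \<rat>) = UNIV"
proof -
  have "p \<in> closure (to_circle ` \<rat>)" for p
    unfolding closure_approachable
  proof (intro allI impI)
    fix e :: real assume "e > 0"
    obtain x where x: "p = to_circle x" by (rule to_circle_cases)
    obtain r :: real where r: "r \<in> \<rat>" "x < r" "r < x + e"
      using Rats_dense_in_real[of x "x + e"] \<open>e > 0\<close> by auto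
    then have "dist (to_circle r) p < e"
      unfolding x using dist_circle_le[of r x] by simp
    then show "\<exists>y\<in>to_circle ` \<rat>. dist y p < e" using r by blast
  qed
  then show ?thesis by auto
qed


section \<open>Degree one maps with dense image\<close>

lemma circle_lift_add_int:
  assumes "is_circle_lift F f"
  shows "F (x + of_int n) = F x + of_int n"
proof (induction n rule: int_induct[where k = 0])
  case (step1 i)
  then show ?case
    using assms unfolding is_circle_lift_def by (metis add.assoc of_int_1 of_int_add)
next
  case (step2 i)
  have "F (x + of_int (i - 1) + 1) = F (x + of_int (i - 1)) + 1"
    using assms unfolding is_circle_lift_def by blast
  with step2 show ?case by simp
qed simp

text \<open>A value of \<open>F\<close> is first found near \<open>x\<close> only modulo integers;
  shifting its argument by an integer moves the value next to \<open>x\<close> itself.\<close>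

lemma dense_range_lift:
  assumes "is_circle_lift F f" "closure (range f) = UNIV"
  shows "closure (range F) = UNIV"
proof -
  have "x \<in> closure (range F)" for x
    unfolding closure_approachable
  proof (intro allI impI)
    fix e :: real assume "e > 0"
    then obtain p where "dist (f p) (to_circle x) < e"
      using assms(2) closure_approachable[of "to_circle x" "range f"] by auto
    moreover obtain t where "p = to_circle t" by (rule to_circle_cases)
    ultimately have "dist (to_circle x) (to_circle (F t)) < e"
      using assms(1) by (simp add: is_circle_lift_def dist_commute)
    then obtain y where y: "to_circle (F t) = to_circle y" "\<bar>x - y\<bar> < e"
      by (rule dist_circle_lessE)
    obtain n :: int where "y - F t = of_int n"
      using y(1) by (metis to_circle_eq_iff Ints_cases)
    then have "F (t + of_int n) = y" using circle_lift_add_int[OF assms(1)] by simp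
    then show "\<exists>z\<in>range F. dist z x < e" using y(2) by (auto simp: dist_real_def abs_minus_commute)
  qed
  then show ?thesis by auto
qed

text \<open>A jump would leave a gap in the image. Concretely, density gives values slightly above
  and below \<open>F x\<close>, and monotonicity confines \<open>F\<close> between them near
  \<open>x\<close>.\<close>

lemma continuous_mono_dense_range:
  fixes F :: "real \<Rightarrow> real"
  assumes F: "mono F" and dense: "closure (range F) = UNIV"
  shows "continuous_on UNIV F"
proof -
  have hit: "\<exists>y. a < F y \<and> F y < b" if "a < b" for a b
  proof -
    have "{a<..<b} \<inter> range F \<noteq> {}"
      using open_Int_closure_eq_empty[of "{a<..<b}" "range F"] dense that by auto
    then show ?thesis by auto
  qed
  have "\<exists>d>0. \<forall>x'. dist x' x < d \<longrightarrow> dist (F x') (F x) < e" if e: "e > 0" for x e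
  proof -
    obtain y where y: "F x < F y" "F y < F x + e" using hit[of "F x" "F x + e"] e by auto
    obtain z where z: "F x - e < F z" "F z < F x" using hit[of "F x - e" "F x"] e by auto
    \<comment> \<open>A monotone map takes a strictly larger value only at a larger argument, so
      \<open>z\<close> and \<open>y\<close> bracket \<open>x\<close>.\<close>
    have lt: "x < y" "z < x"
      using monoD[OF F, of y x] monoD[OF F, of x z] y z by (meson not_le)+
    show ?thesis
    proof (intro exI[of _ "min (y - x) (x - z)"] conjI allI impI)
      fix x' assume "dist x' x < min (y - x) (x - z)"
      then have "z \<le> x'" "x' \<le> y" by (auto simp: dist_real_def)
      then have "F z \<le> F x'" "F x' \<le> F y" using monoD[OF F] by blast+
      then show "dist (F x') (F x) < e" using y z by (auto simp: dist_real_def)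
    qed (use lt in auto)
  qed
  then show ?thesis by (auto simp: continuous_on_iff)
qed

text \<open>The circle carries the quotient topology, so openness of a preimage under
  \<open>f\<close> is tested on the line, where it becomes a preimage under
  \<open>F\<close>.\<close>

lemma continuous_circle_map:
  assumes "is_circle_lift F f" "continuous_on UNIV F"
  shows "continuous_on UNIV f"
proof (subst continuous_on_open_vimage, simp, intro allI impI)
  fix B :: "circle set" assume "open B"
  have "to_circle -` (f -` B) = F -` (to_circle -` B)"
    using assms(1) by (auto simp: is_circle_lift_def)
  moreover have "open (F -` (to_circle -` B))"
    using assms(2) \<open>open B\<close> by (auto simp: open_circle_iff_quotient continuous_on_open_vimage)
  ultimately show "open (f -` B \<inter> UNIV)" by (simp add: open_circle_iff_quotient)
qed

lemma continuous_nondecreasing_degree_one: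
  assumes "nondecreasing_degree_one f" "closure (range f) = UNIV"
  shows "continuous_on UNIV f"
  using assms continuous_circle_map continuous_mono_dense_range dense_range_lift
  unfolding nondecreasing_degree_one_iff_lift by blast


section \<open>Equivariant closed sets attached to a circle map\<close>

text \<open>The closure of the image would be equivariant as well, but a jump point may contribute an
  isolated value to it, which no fixed countable set of points detects; requiring non-empty interior
  discards such values, so that for monotone maps rational points suffice and the set depends
  measurably on the map.\<close>

definition essential_range :: "(circle \<Rightarrow> circle) \<Rightarrow> circle set" where
  "essential_range f = - \<Union>{U. open U \<and> interior (f -` U) = {}}"

text \<open>If \<open>f\<close> has a continuous non-decreasing lift, this is the projection of the
  support of the Stieltjes measure of that lift.\<close>

definition variation_support :: "(circle \<Rightarrow> circle) \<Rightarrow> circle set" where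
  "variation_support f = - \<Union>{U. open U \<and> f constant_on U}"

lemma closed_essential_range: "closed (essential_range f)"
  unfolding essential_range_def by (intro closed_Compl open_Union) auto

lemma closed_variation_support: "closed (variation_support f)"
  unfolding variation_support_def by (intro closed_Compl open_Union) auto

text \<open>The complement of the closed image is open with empty preimage. Hence a full essential
  range forces a dense image.\<close>

lemma essential_range_subset_closure: "essential_range f \<subseteq> closure (range f)"
proof -
  have "f -` (- closure (range f)) = {}" using closure_subset[of "range f"] by auto
  then have "interior (f -` (- closure (range f))) = {}" by simp
  then have "- closure (range f) \<subseteq> - essential_range f"
    unfolding essential_range_def using open_Compl[OF closed_closure, of "range f"] by blast
  then show ?thesis by blast
qed

section \<open>Equivariance under intertwining homeomorphisms\<close>

lemma homeo_plus_homeomorphism: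
  assumes "h \<in> homeo_plus"
  obtains k where "homeomorphism UNIV UNIV h k"
  using assms by (auto simp: homeo_plus_def)

text \<open>The set lives on the target side, so it is moved by \<open>h\<close>; \<open>k\<close>
  only transports interiors of preimages. With \<open>f\<close> and \<open>g\<close> the maps at
  \<omega> and at its translate, this is equivariance under \<sigma>1.\<close>

lemma essential_range_intertwine:
  assumes h: "homeomorphism UNIV UNIV h h'" and k: "homeomorphism UNIV UNIV k k'"
    and eq: "h \<circ> f = g \<circ> k"
  shows "essential_range g = h ` essential_range f"
proof -
  \<comment> \<open>One inclusion is proved for arbitrary data, so that it can be reused for the
    inverse homeomorphisms with \<open>f\<close> and \<open>g\<close> exchanged.\<close>
  have *: "h ` essential_range f \<subseteq> essential_range g"
    if h: "homeomorphism UNIV UNIV h h'" and k: "homeomorphism UNIV UNIV k k'"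
      and eq: "h \<circ> f = g \<circ> k" for h h' k k' :: "circle \<Rightarrow> circle" and f g
  proof (rule image_subsetI, rule ccontr)
    fix p assume p: "p \<in> essential_range f" "h p \<notin> essential_range g"
    then obtain U where U: "open U" "h p \<in> U" "interior (g -` U) = {}"
      unfolding essential_range_def by auto
    have "open (h -` U)"
      using U(1) h by (auto simp: homeomorphism_def continuous_on_open_vimage)
    then have ne: "interior (f -` (h -` U)) \<noteq> {}"
      using p(1) U(2) unfolding essential_range_def by auto
    have "open (k' -` interior (f -` (h -` U)))"
      using k by (auto simp: homeomorphism_def continuous_on_open_vimage)
    \<comment> \<open>The preimage under \<open>k'\<close> is the image under \<open>k\<close>: an
      open part of the \<open>f\<close>-preimage is carried into the \<open>g\<close>-preimage of
      \<open>U\<close>.\<close>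
    moreover have "k' -` interior (f -` (h -` U)) \<subseteq> g -` U"
    proof
      fix x assume "x \<in> k' -` interior (f -` (h -` U))"
      then have "h (f (k' x)) \<in> U" using interior_subset by blast
      moreover have "h (f (k' x)) = g x"
        using fun_cong[OF eq, of "k' x"] k by (simp add: homeomorphism_def)
      ultimately show "x \<in> g -` U" by simp
    qed
    ultimately have "k' -` interior (f -` (h -` U)) = {}" using U(3) interior_maximal by blast
    moreover have "surj k'" using k by (simp add: homeomorphism_def)
    ultimately show False using ne by (metis image_empty surj_image_vimage_eq)
  qed
  have "h' \<circ> g = f \<circ> k'"
  proof
    fix x
    have "h' (g (k (k' x))) = h' (h (f (k' x)))" using fun_cong[OF eq, of "k' x"] by simp
    then show "(h' \<circ> g) x = (f \<circ> k') x" using h k by (simp add: homeomorphism_def)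
  qed
  then have "h' ` essential_range g \<subseteq> essential_range f"
    using *[OF homeomorphism_symD[OF h] homeomorphism_symD[OF k]] by blast
  then have "h ` h' ` essential_range g \<subseteq> h ` essential_range f" by (rule image_mono)
  then show ?thesis using *[OF h k eq] h by (auto simp: homeomorphism_def image_image)
qed

text \<open>Local constancy is a property on the source side, so this set is moved by
  \<open>k\<close>, which will be \<sigma>2, and \<open>h\<close> only changes the constant.\<close>

lemma variation_support_intertwine:
  assumes h: "homeomorphism UNIV UNIV h h'" and k: "homeomorphism UNIV UNIV k k'"
    and eq: "h \<circ> f = g \<circ> k"
  shows "variation_support g = k ` variation_support f"
proof -
  have *: "k ` variation_support f \<subseteq> variation_support g"
    if h: "homeomorphism UNIV UNIV h h'" and k: "homeomorphism UNIV UNIV k k'"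
      and eq: "h \<circ> f = g \<circ> k" for h h' k k' :: "circle \<Rightarrow> circle" and f g
  proof (rule image_subsetI, rule ccontr)
    fix p assume p: "p \<in> variation_support f" "k p \<notin> variation_support g"
    then obtain U c where U: "open U" "k p \<in> U" "\<And>x. x \<in> U \<Longrightarrow> g x = c"
      unfolding variation_support_def constant_on_def by auto
    have "open (k -` U)"
      using U(1) k by (auto simp: homeomorphism_def continuous_on_open_vimage)
    moreover have "f x = h' c" if "x \<in> k -` U" for x
      using U(3)[of "k x"] that fun_cong[OF eq, of x] h
      by (metis (no_types, lifting) UNIV_I comp_apply homeomorphism_def vimageE)
    ultimately show False using p(1) U(2) unfolding variation_support_def constant_on_def by blast
  qed
  have "h' \<circ> g = f \<circ> k'"
  proof
    fix x
    have "h' (g (k (k' x))) = h' (h (f (k' x)))" using fun_cong[OF eq, of "k' x"] by simp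
    then show "(h' \<circ> g) x = (f \<circ> k') x" using h k by (simp add: homeomorphism_def)
  qed
  then have "k' ` variation_support g \<subseteq> variation_support f"
    using *[OF homeomorphism_symD[OF h] homeomorphism_symD[OF k]] by blast
  then have "k ` k' ` variation_support g \<subseteq> k ` variation_support f" by (rule image_mono)
  then show ?thesis using *[OF h k eq] k by (auto simp: homeomorphism_def image_image)
qed

text \<open>The right limit of a lift at any point projects into the essential range.\<close>

lemma essential_range_right_limit:
  assumes "nondecreasing_degree_one f"
  obtains p where "p \<in> essential_range f"
    "\<And>U b. open U \<Longrightarrow> p \<in> U \<Longrightarrow> x < b \<Longrightarrow> \<exists>t\<in>\<rat>. x < t \<and> t < b \<and> f (to_circle t) \<in> U"
proof -
  obtain F where F: "mono F" "is_circle_lift F f"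
    using assms unfolding nondecreasing_degree_one_iff_lift by auto
  \<comment> \<open>For a monotone \<open>F\<close> the infimum over larger arguments is the right
    limit at \<open>x\<close>.\<close>
  define L where "L = (INF t\<in>{x<..}. F t)"
  have bdd: "bdd_below (F ` {x<..})"
    by (rule bdd_belowI[of _ "F x"]) (auto intro: monoD[OF F(1)])
  have nbhd: "\<exists>y>x. \<forall>t. x < t \<and> t < y \<longrightarrow> f (to_circle t) \<in> U"
    if U: "open U" "to_circle L \<in> U" for U
  proof -
    obtain e where e: "e > 0" "ball (to_circle L) e \<subseteq> U" using U open_contains_ball by blast
    have "Inf (F ` {x<..}) < L + e" using e by (simp add: L_def)
    then obtain y where y: "x < y" "F y < L + e"
      using cInf_lessD[of "F ` {x<..}" "L + e"] by auto
    have "f (to_circle t) \<in> U" if t: "x < t" "t < y" for t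
    proof -
      have "L \<le> F t" unfolding L_def using t by (intro cINF_lower[OF bdd]) auto
      moreover have "F t \<le> F y" using t monoD[OF F(1), of t y] by simp
      ultimately have "dist (to_circle L) (to_circle (F t)) < e"
        using dist_circle_le[of L "F t"] y by simp
      then show ?thesis using e(2) F(2) by (auto simp: is_circle_lift_def)
    qed
    then show ?thesis using y(1) by blast
  qed
  show ?thesis
  proof (rule that[of "to_circle L"])
    \<comment> \<open>A whole interval to the right of \<open>x\<close> goes into \<open>U\<close>,
      which is what non-empty interior asks for.\<close>
    have "interior (f -` U) \<noteq> {}" if "open U" "to_circle L \<in> U" for U
    proof -
      obtain y where y: "x < y" "\<forall>t. x < t \<and> t < y \<longrightarrow> f (to_circle t) \<in> U"
        using nbhd \<open>open U\<close> \<open>to_circle L \<in> U\<close> by blast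
      then have "to_circle ` {x<..<y} \<subseteq> interior (f -` U)"
        by (intro interior_maximal open_to_circle_image) auto
      moreover have "(x + y) / 2 \<in> {x<..<y}" using y(1) by simp
      ultimately show ?thesis by blast
    qed
    then show "to_circle L \<in> essential_range f" unfolding essential_range_def by blast
  next
    fix U b assume "open U" "to_circle L \<in> U" "x < b"
    then obtain y where y: "x < y" "\<forall>t. x < t \<and> t < y \<longrightarrow> f (to_circle t) \<in> U"
      using nbhd by blast
    obtain t where "t \<in> \<rat>" "x < t" "t < min y b"
      using Rats_dense_in_real[of x "min y b"] y \<open>x < b\<close> by auto
    then show "\<exists>t\<in>\<rat>. x < t \<and> t < b \<and> f (to_circle t) \<in> U" using y(2) by auto
  qed
qed

section \<open>Non-emptiness and countable descriptions by rational points\<close>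

lemma essential_range_nonempty:
  assumes "nondecreasing_degree_one f"
  shows "essential_range f \<noteq> {}"
  using essential_range_right_limit[OF assms] by blast

text \<open>Rewrites the hit event through values at rational points. The smaller closed ball is
  essential: membership in it passes to the right limit at \<open>a\<close>, which then still lies
  in the open ball.\<close>

lemma essential_range_meets_ball_iff:
  assumes "nondecreasing_degree_one f"
  shows "essential_range f \<inter> ball q r \<noteq> {} \<longleftrightarrow>
    (\<exists>n. \<exists>a\<in>\<rat>. \<exists>b\<in>\<rat>. a < b \<and>
      (\<forall>t\<in>\<rat>. a < t \<and> t < b \<longrightarrow> f (to_circle t) \<in> cball q (r - 1 / real (Suc n))))"
    (is "_ \<longleftrightarrow> ?R")
proof
  assume "essential_range f \<inter> ball q r \<noteq> {}"
  then obtain p where p: "p \<in> essential_range f" "dist q p < r" by auto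
  then obtain n where n: "1 / real (Suc n) < r - dist q p"
    using reals_Archimedean[of "r - dist q p"] by (auto simp: inverse_eq_divide)
  \<comment> \<open>The radius is shrunk by less than the slack \<open>r - dist q p\<close>, so
    \<open>p\<close> stays inside.\<close>
  define U where "U = ball q (r - 1 / real (Suc n))"
  have "open U" "p \<in> U" using n by (auto simp: U_def)
  then have "interior (f -` U) \<noteq> {}" using p(1) unfolding essential_range_def by blast
  then obtain z where z: "z \<in> interior (f -` U)" by blast
  obtain x where x: "z = to_circle x" by (rule to_circle_cases)
  obtain e where e: "e > 0" "ball z e \<subseteq> f -` U" using z mem_interior by blast
  obtain a where a: "a \<in> \<rat>" "x - e < a" "a < x"
    using Rats_dense_in_real[of "x - e" x] e by auto
  obtain b where b: "b \<in> \<rat>" "x < b" "b < x + e"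
    using Rats_dense_in_real[of x "x + e"] e by auto
  have "f (to_circle t) \<in> cball q (r - 1 / real (Suc n))" if "a < t" "t < b" for t
  proof -
    have "to_circle t \<in> ball z e"
      unfolding x ball_to_circle using that a b by (auto simp: dist_real_def)
    then have "f (to_circle t) \<in> U" using e(2) by blast
    then show ?thesis by (simp add: U_def)
  qed
  then show ?R using a b by (meson order.strict_trans)
next
  assume ?R
  then obtain n a b where ab: "a < b"
    "\<And>t. t \<in> \<rat> \<Longrightarrow> a < t \<Longrightarrow> t < b \<Longrightarrow> f (to_circle t) \<in> cball q (r - 1 / real (Suc n))"
    by blast
  obtain p where p: "p \<in> essential_range f"
    "\<And>U b. open U \<Longrightarrow> p \<in> U \<Longrightarrow> a < b \<Longrightarrow> \<exists>t\<in>\<rat>. a < t \<and> t < b \<and> f (to_circle t) \<in> U"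
    using essential_range_right_limit[OF assms, of a] by metis
  \<comment> \<open>Otherwise rational points just to the right of \<open>a\<close> would have
    values near \<open>p\<close>, outside the closed ball.\<close>
  have "p \<in> cball q (r - 1 / real (Suc n))"
  proof (rule ccontr)
    assume "p \<notin> cball q (r - 1 / real (Suc n))"
    then obtain t where "t \<in> \<rat>" "a < t" "t < b" "f (to_circle t) \<in> - cball q (r - 1 / real (Suc n))"
      using p(2)[of "- cball q (r - 1 / real (Suc n))" b] ab(1) closed_cball
      by (metis ComplI open_Compl)
    then show False using ab(2) by auto
  qed
  moreover have "1 / real (Suc n) > 0" by simp
  ultimately have "p \<in> ball q r" unfolding mem_cball mem_ball by linarith
  then show "essential_range f \<inter> ball q r \<noteq> {}" using p(1) by blast
qed

text \<open>Off the support the map is locally constant, and connectedness makes it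
  constant.\<close>

lemma constant_on_connected_variation_support:
  assumes "connected A" "variation_support f \<inter> A = {}"
  shows "f constant_on A"
proof -
  have "f a = f b" if "a \<in> A" "b \<in> A" for a b
  proof (rule connected_local_const[OF assms(1) that], rule ballI)
    fix x assume "x \<in> A"
    then obtain U where U: "open U" "x \<in> U" "f constant_on U"
      using assms(2) unfolding variation_support_def by blast
    then have "eventually (\<lambda>y. y \<in> U) (at x within A)"
      using eventually_at_topological by blast
    then show "eventually (\<lambda>y. f x = f y) (at x within A)"
      by (rule eventually_mono) (use U in \<open>auto simp: constant_on_def\<close>)
  qed
  then show ?thesis unfolding constant_on_def by metis
qed

text \<open>Balls are connected, so two distinct values force a point of the support. Conversely, by
  continuity, agreement at the rational points of the ball spreads to the whole ball.\<close>

lemma variation_support_meets_ball_iff: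
  assumes "continuous_on UNIV f"
  shows "variation_support f \<inter> ball q r \<noteq> {} \<longleftrightarrow>
    (\<exists>s\<in>\<rat>. \<exists>t\<in>\<rat>. to_circle s \<in> ball q r \<and> to_circle t \<in> ball q r \<and>
      f (to_circle s) \<noteq> f (to_circle t))" (is "_ \<longleftrightarrow> ?R")
proof
  assume ?R
  then have "\<not> f constant_on ball q r" unfolding constant_on_def by metis
  then show "variation_support f \<inter> ball q r \<noteq> {}"
    using constant_on_connected_variation_support[OF connected_ball_circle] by blast
next
  assume *: "variation_support f \<inter> ball q r \<noteq> {}"
  show ?R
  proof (rule ccontr)
    assume "\<not> ?R"
    then obtain c where c: "\<And>x. x \<in> ball q r \<inter> to_circle ` \<rat> \<Longrightarrow> f x = c" by blast
    have "ball q r \<subseteq> closure (ball q r \<inter> to_circle ` \<rat>)"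
      using open_Int_closure_subset[of "ball q r" "to_circle ` \<rat>"]
      by (simp add: closure_to_circle_Rats)
    also have "\<dots> \<subseteq> f -` {c}"
      using assms c by (intro closure_minimal) (auto simp: continuous_on_closed_vimage)
    finally have "f constant_on ball q r" unfolding constant_on_def by blast
    then have "ball q r \<inter> variation_support f = {}" unfolding variation_support_def by blast
    then show False using * by blast
  qed
qed

text \<open>Otherwise the map is constant on the connected circle, and a single point is not
  dense.\<close>

lemma variation_support_nonempty:
  assumes "closure (range f) = UNIV"
  shows "variation_support f \<noteq> {}"
proof
  assume "variation_support f = {}"
  then have "f constant_on UNIV"
    using constant_on_connected_variation_support[OF connected_circle] by blast
  then obtain c where "range f \<subseteq> {c}" unfolding constant_on_def by blast
  then have "closure (range f) \<subseteq> {c}" by (simp add: closure_minimal)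
  then have "to_circle 0 = to_circle (1/2)" using assms by (metis UNIV_I singletonD subsetD)
  then obtain n :: int where "- (1/2 :: real) = of_int n"
    by (auto simp: to_circle_eq_iff elim: Ints_cases)
  then have "of_int (- 2 * n) = (1 :: real)" by simp
  then have "- 2 * n = 1" using of_int_eq_1_iff by blast
  then show False by presburger
qed

text \<open>Density makes the lift continuous, and full variation support excludes flat intervals,
  so the lift is strictly increasing. Injectivity follows within one period; compactness supplies
  surjectivity and a continuous inverse.\<close>

lemma homeo_plusI:
  assumes f: "nondecreasing_degree_one f" and dense: "closure (range f) = UNIV"
    and var: "variation_support f = UNIV"
  shows "f \<in> homeo_plus"
proof -
  obtain F where F: "mono F" "is_circle_lift F f"
    using f unfolding nondecreasing_degree_one_iff_lift by auto
  have lift: "f (to_circle x) = to_circle (F x)" "F (x + 1) = F x + 1" for x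
    using F(2) by (auto simp: is_circle_lift_def)
  have cont: "continuous_on UNIV F"
    using continuous_mono_dense_range dense_range_lift F dense by blast
  have "strict_mono F"
  proof (rule strict_monoI, rule ccontr)
    fix x y :: real assume xy: "x < y" "\<not> F x < F y"
    have "F t = F x" if "x < t" "t < y" for t
      using monoD[OF F(1), of x t] monoD[OF F(1), of t y] xy that by auto
    then have "f constant_on to_circle ` {x<..<y}"
      unfolding constant_on_def by (auto simp: lift)
    then have "to_circle ` {x<..<y} \<subseteq> - variation_support f"
      using open_to_circle_image[of "{x<..<y}"] unfolding variation_support_def by auto
    moreover have "(x + y) / 2 \<in> {x<..<y}" using xy(1) by simp
    ultimately show False using var by blast
  qed
  have "inj f"
  proof (rule injI)
    fix p q assume eq: "f p = f q"
    obtain x where x: "p = to_circle x" by (rule to_circle_cases)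
    obtain y where y: "q = to_circle y" "x \<le> y" "y < x + 1" by (rule to_circle_rep)
    \<comment> \<open>Strictness places both values in one half-open period, where representatives
      are unique.\<close>
    have "F x \<le> F y" "F y < F x + 1"
      using y monoD[OF F(1)] strict_monoD[OF \<open>strict_mono F\<close> y(3)] by (auto simp: lift)
    then have "F x = F y"
      using eq x y by (intro to_circle_eq_unique[of _ _ "F x"]) (auto simp: lift)
    then show "p = q" using x y \<open>strict_mono F\<close> by (simp add: strict_mono_eq)
  qed
  moreover have "continuous_on UNIV f" using continuous_circle_map F(2) cont by blast
  moreover from this have "range f = UNIV"
    using compact_continuous_image[OF _ compact_circle] dense
    by (metis closure_closed compact_imp_closed)
  ultimately obtain g where "homeomorphism UNIV UNIV f g"
    using homeomorphism_compact[OF compact_circle] by blast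
  then show ?thesis unfolding homeo_plus_def using cont \<open>strict_mono F\<close> F(2) by blast
qed


section \<open>Measurability of set-valued maps\<close>

text \<open>Finite nets reduce a closed set, up to a small Hausdorff error, to the finite pattern of
  net balls it meets. Preimages of open sets become countable unions of events on such
  patterns.\<close>

lemma measurable_hausdorffI:
  fixes \<Phi> :: "'w \<Rightarrow> circle set"
  assumes closed: "\<And>\<omega>. \<omega> \<in> space M \<Longrightarrow> \<Phi> \<omega> \<in> closed_nonempty"
    and hits: "\<And>p r. Measurable.pred M (\<lambda>\<omega>. \<Phi> \<omega> \<inter> ball p r \<noteq> {})"
  shows "\<Phi> \<in> M \<rightarrow>\<^sub>M borel_of hausdorff_topology"
proof -
  interpret H: Metric_space closed_nonempty hausdorff_dist by (rule Metric_space_hausdorff)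
  have top: "topspace hausdorff_topology = closed_nonempty"
    unfolding hausdorff_topology_def by simp
  have "\<exists>D :: circle set. finite D \<and> UNIV \<subseteq> (\<Union>d\<in>D. ball d (1 / real (Suc n)))" for n
  proof -
    have "0 < 1 / real (Suc n)" by simp
    then show ?thesis
      using seq_compact_imp_totally_bounded[OF compact_imp_seq_compact[OF compact_circle]] by blast
  qed
  then obtain D :: "nat \<Rightarrow> circle set"
    where D: "\<And>n. finite (D n)" "\<And>n. UNIV \<subseteq> (\<Union>d\<in>D n. ball d (1 / real (Suc n)))"
    by metis
  \<comment> \<open>The net centres whose ball meets \<open>A\<close>: a finite stand-in for
    \<open>A\<close>.\<close>
  define P where "P n A = {d \<in> D n. A \<inter> ball d (1 / real (Suc n)) \<noteq> {}}" for n A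
  have P: "P n A \<in> closed_nonempty" "hausdorff_dist A (P n A) \<le> 1 / real (Suc n)"
    if A: "A \<in> closed_nonempty" for n A
  proof -
    have near: "\<exists>d\<in>P n A. dist a d \<le> 1 / real (Suc n)" if "a \<in> A" for a
    proof -
      obtain d where "d \<in> D n" "a \<in> ball d (1 / real (Suc n))" using D(2)[of n] by blast
      then show ?thesis using \<open>a \<in> A\<close> by (intro bexI[of _ d]) (auto simp: P_def dist_commute)
    qed
    have ne: "A \<noteq> {}" "P n A \<noteq> {}" using A near by (auto simp: closed_nonempty_def)
    show "P n A \<in> closed_nonempty"
      using ne D(1)[of n] by (auto simp: closed_nonempty_def P_def intro!: finite_imp_closed)
    show "hausdorff_dist A (P n A) \<le> 1 / real (Suc n)"
      unfolding hausdorff_dist_le_iff[OF ne]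
    proof (intro conjI ballI)
      fix a assume "a \<in> A"
      then show "infdist a (P n A) \<le> 1 / real (Suc n)" using near infdist_le2 by blast
    next
      fix d assume "d \<in> P n A"
      then obtain a where "a \<in> A" "dist d a < 1 / real (Suc n)" by (auto simp: P_def)
      then show "infdist d A \<le> 1 / real (Suc n)" using infdist_le2 less_imp_le by blast
    qed
  qed
  have "\<Phi> -` U \<inter> space M \<in> sets M" if U: "openin hausdorff_topology U" for U
  proof -
    \<comment> \<open>Patterns whose Hausdorff neighbourhood lies in \<open>U\<close>. The radius is
      twice the approximation error, so the set being approximated belongs to that
      neighbourhood.\<close>
    define G where "G n = {E \<in> Pow (D n). \<forall>B\<in>closed_nonempty.
        hausdorff_dist E B < 2 / real (Suc n) \<longrightarrow> B \<in> U}" for n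
    have "\<Phi> \<omega> \<in> U \<longleftrightarrow> (\<exists>n. P n (\<Phi> \<omega>) \<in> G n)" if \<omega>: "\<omega> \<in> space M" for \<omega>
    proof
      assume "\<exists>n. P n (\<Phi> \<omega>) \<in> G n"
      then obtain n where n: "P n (\<Phi> \<omega>) \<in> G n" ..
      have "hausdorff_dist (P n (\<Phi> \<omega>)) (\<Phi> \<omega>) \<le> 1 / real (Suc n)"
        using P(2)[OF closed[OF \<omega>], of n] by (simp add: H.commute)
      also have "\<dots> < 2 / real (Suc n)" by (simp add: divide_strict_right_mono)
      finally show "\<Phi> \<omega> \<in> U" using n closed[OF \<omega>] unfolding G_def by blast
    next
      assume "\<Phi> \<omega> \<in> U"
      then obtain r where r: "r > 0" "H.mball (\<Phi> \<omega>) r \<subseteq> U"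
        using U unfolding hausdorff_topology_def H.openin_mtopology by blast
      \<comment> \<open>One third, because the approximation error and the radius used in
        \<open>G\<close> add up to three units.\<close>
      obtain n where n: "1 / real (Suc n) < r / 3"
        using reals_Archimedean[of "r / 3"] r(1) by (auto simp: inverse_eq_divide)
      have "B \<in> U" if B: "B \<in> closed_nonempty" "hausdorff_dist (P n (\<Phi> \<omega>)) B < 2 / real (Suc n)" for B
      proof -
        have "hausdorff_dist (\<Phi> \<omega>) B \<le> hausdorff_dist (\<Phi> \<omega>) (P n (\<Phi> \<omega>)) + hausdorff_dist (P n (\<Phi> \<omega>)) B"
          using H.triangle closed[OF \<omega>] P(1)[OF closed[OF \<omega>]] B(1) by blast
        also have "\<dots> < 1 / real (Suc n) + 2 / real (Suc n)"
          using P(2)[OF closed[OF \<omega>], of n] B(2) by linarith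
        also have "\<dots> < r" using n by (simp add: field_simps)
        finally show ?thesis using r(2) closed[OF \<omega>] B(1) by auto
      qed
      then have "P n (\<Phi> \<omega>) \<in> G n" unfolding G_def P_def by auto
      then show "\<exists>n. P n (\<Phi> \<omega>) \<in> G n" ..
    qed
    \<comment> \<open>Since \<open>G n\<close> and \<open>D n\<close> are finite, this is a finite
      Boolean combination of hit events.\<close>
    moreover have "P n A \<in> G n \<longleftrightarrow> (\<exists>E\<in>G n. \<forall>d\<in>D n. (A \<inter> ball d (1 / real (Suc n)) \<noteq> {}) = (d \<in> E))" for n A
    proof
      assume "P n A \<in> G n"
      then show "\<exists>E\<in>G n. \<forall>d\<in>D n. (A \<inter> ball d (1 / real (Suc n)) \<noteq> {}) = (d \<in> E)"
        by (intro bexI[of _ "P n A"]) (auto simp: P_def)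
    next
      assume "\<exists>E\<in>G n. \<forall>d\<in>D n. (A \<inter> ball d (1 / real (Suc n)) \<noteq> {}) = (d \<in> E)"
      then obtain E where E: "E \<in> G n" "\<forall>d\<in>D n. (A \<inter> ball d (1 / real (Suc n)) \<noteq> {}) = (d \<in> E)" ..
      moreover have "E \<subseteq> D n" using E(1) by (auto simp: G_def)
      ultimately have "P n A = E" unfolding P_def by blast
      then show "P n A \<in> G n" using E(1) by simp
    qed
    ultimately have "\<Phi> -` U \<inter> space M = {\<omega> \<in> space M. \<exists>n. \<exists>E\<in>G n. \<forall>d\<in>D n.
        (\<Phi> \<omega> \<inter> ball d (1 / real (Suc n)) \<noteq> {}) = (d \<in> E)}" by auto
    moreover have "Measurable.pred M (\<lambda>\<omega>. \<exists>n. \<exists>E\<in>G n. \<forall>d\<in>D n.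
        (\<Phi> \<omega> \<inter> ball d (1 / real (Suc n)) \<noteq> {}) = (d \<in> E))"
    proof -
      have "finite (G n)" for n using D(1)[of n] by (simp add: G_def)
      then show ?thesis
        using D(1)
        by (intro pred_intros_countable pred_intros_finite pred_intros_logic(6) hits) auto
    qed
    ultimately show ?thesis by (simp add: pred_def)
  qed
  then show ?thesis
    unfolding borel_of_def using closed openin_subset[of hausdorff_topology]
    by (intro measurable_measure_of) (auto simp: top)
qed

lemma pred_countable_bounded:
  assumes "countable I" "\<And>i. i \<in> I \<Longrightarrow> Measurable.pred M (P i)"
  shows "Measurable.pred M (\<lambda>x. \<forall>i\<in>I. P i x)" "Measurable.pred M (\<lambda>x. \<exists>i\<in>I. P i x)"
  using assms unfolding pred_def
  by (auto intro: sets.sets_Collect_countable_All' sets.sets_Collect_countable_Ex')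

text \<open>Distinct points are separated by one of countably many balls: a rational centre within
  less than half their distance of the first point is farther than that from the second.\<close>

lemma pred_neq_circle:
  fixes f g :: "'w \<Rightarrow> circle"
  assumes "f \<in> M \<rightarrow>\<^sub>M borel" "g \<in> M \<rightarrow>\<^sub>M borel"
  shows "Measurable.pred M (\<lambda>\<omega>. f \<omega> \<noteq> g \<omega>)"
proof -
  have "f \<omega> \<noteq> g \<omega> \<longleftrightarrow> (\<exists>n. \<exists>t\<in>\<rat>. f \<omega> \<in> ball (to_circle t) (1 / real (Suc n)) \<and>
      g \<omega> \<notin> ball (to_circle t) (1 / real (Suc n)))" for \<omega>
  proof
    assume "f \<omega> \<noteq> g \<omega>"
    then obtain n where n: "1 / real (Suc n) < dist (f \<omega>) (g \<omega>) / 2"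
      using reals_Archimedean[of "dist (f \<omega>) (g \<omega>) / 2"] by (auto simp: inverse_eq_divide)
    have "f \<omega> \<in> closure (to_circle ` \<rat>)" by (simp add: closure_to_circle_Rats)
    then obtain t where t: "t \<in> \<rat>" "dist (to_circle t) (f \<omega>) < 1 / real (Suc n)"
      unfolding closure_approachable
      by (metis divide_pos_pos imageE of_nat_0_less_iff zero_less_Suc zero_less_one)
    have "\<not> dist (to_circle t) (g \<omega>) < 1 / real (Suc n)"
      using dist_triangle3[of "f \<omega>" "g \<omega>" "to_circle t"] t(2) n by linarith
    then show "\<exists>n. \<exists>t\<in>\<rat>. f \<omega> \<in> ball (to_circle t) (1 / real (Suc n)) \<and>
      g \<omega> \<notin> ball (to_circle t) (1 / real (Suc n))" using t by (auto simp: mem_ball)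
  qed auto
  moreover have "Measurable.pred M (\<lambda>\<omega>. \<exists>n. \<exists>t\<in>\<rat>. f \<omega> \<in> ball (to_circle t) (1 / real (Suc n)) \<and>
      g \<omega> \<notin> ball (to_circle t) (1 / real (Suc n)))"
    using assms by (intro pred_intros_countable pred_countable_bounded countable_rat
        pred_intros_logic pred_sets2[where N = borel]) auto
  ultimately show ?thesis by simp
qed


section \<open>Minimal cocycles\<close>

text \<open>Holds at every point, not just almost everywhere, since a measurable map takes values in
  the underlying space of its target.\<close>

lemma measurable_cocycle_homeo_plus:
  assumes "measurable_cocycle \<Gamma> M act \<sigma>" "\<gamma> \<in> carrier \<Gamma>" "\<omega> \<in> space M"
  shows "\<sigma> \<gamma> \<omega> \<in> homeo_plus"
proof -
  have "(\<lambda>(\<gamma>, \<omega>). \<sigma> \<gamma> \<omega>) \<in> count_space (carrier \<Gamma>) \<Otimes>\<^sub>M M \<rightarrow>\<^sub>M borel_of compact_open_topology"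
    using assms(1) by (simp add: measurable_cocycle_def)
  from measurable_space[OF this, of "(\<gamma>, \<omega>)"] assms(2,3) show ?thesis
    by (simp add: space_pair_measure borel_of_def space_measure_of_conv)
qed

context standard_borel_probability_gamma_space
begin

lemma AE_act:
  assumes "\<gamma> \<in> carrier \<Gamma>" "AE \<omega> in M. P \<omega>"
  shows "AE \<omega> in M. P (act \<gamma> \<omega>)"
proof -
  have "AE \<omega> in distr M M (act \<gamma>). P \<omega>"
    using assms(2) unfolding act_measure_preserving[OF assms(1)] .
  then show ?thesis by (rule AE_distrD[OF act_measurable[OF assms(1)]])
qed

text \<open>Minimality speaks of maps measurable on all of \<Omega>, while the sets of interest are
  controlled only where \<open>Q\<close> holds. Modification on a null set bridges this;
  \<open>R\<close> is the measurable form of the hit event.\<close>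

lemma minimal_cocycle_AE_UNIV:
  assumes minimal: "minimal_cocycle \<Gamma> M act \<sigma>"
    and \<sigma>: "measurable_cocycle \<Gamma> M act \<sigma>"
    and Q: "AE \<omega> in M. Q \<omega>"
    and closed: "\<And>\<omega>. Q \<omega> \<Longrightarrow> \<Phi> \<omega> \<in> closed_nonempty"
    and hits: "\<And>\<omega> p r. Q \<omega> \<Longrightarrow> \<Phi> \<omega> \<inter> ball p r \<noteq> {} \<longleftrightarrow> R p r \<omega>"
    and R: "\<And>p r. Measurable.pred M (R p r)"
    and equivariant: "\<And>\<gamma>. \<gamma> \<in> carrier \<Gamma> \<Longrightarrow> AE \<omega> in M. \<Phi> (act \<gamma> \<omega>) = \<sigma> \<gamma> \<omega> ` \<Phi> \<omega>"
  shows "AE \<omega> in M. \<Phi> \<omega> = UNIV"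
proof -
  obtain N where N: "{\<omega> \<in> space M. \<not> Q \<omega>} \<subseteq> N" "emeasure M N = 0" "N \<in> sets M"
    using Q by (rule AE_E)
  have AE_N: "AE \<omega> in M. \<omega> \<notin> N"
    using N by (intro AE_not_in) auto
  \<comment> \<open>The value on \<open>N\<close> only has to be a fixed non-empty closed
    set.\<close>
  define \<Psi> where "\<Psi> \<omega> = (if \<omega> \<in> N then UNIV else \<Phi> \<omega>)" for \<omega>
  have "\<Psi> \<in> M \<rightarrow>\<^sub>M borel_of hausdorff_topology"
  proof (rule measurable_hausdorffI)
    fix \<omega> assume "\<omega> \<in> space M"
    then show "\<Psi> \<omega> \<in> closed_nonempty"
      using closed N(1) by (auto simp: \<Psi>_def closed_nonempty_def)
  next
    fix p :: circle and r :: real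
    \<comment> \<open>On \<open>N\<close> the hit event reduces to non-emptiness of the ball, as
      \<open>r\<close> need not be positive.\<close>
    have "Measurable.pred M (\<lambda>\<omega>. (\<omega> \<in> N \<and> ball p r \<noteq> {}) \<or> (\<omega> \<notin> N \<and> R p r \<omega>))"
      using N(3) R by measurable
    moreover have "(\<omega> \<in> N \<and> ball p r \<noteq> {}) \<or> (\<omega> \<notin> N \<and> R p r \<omega>) \<longleftrightarrow> \<Psi> \<omega> \<inter> ball p r \<noteq> {}"
      if "\<omega> \<in> space M" for \<omega>
      using hits[of \<omega> p r] N(1) that by (auto simp: \<Psi>_def)
    ultimately show "Measurable.pred M (\<lambda>\<omega>. \<Psi> \<omega> \<inter> ball p r \<noteq> {})"
      by (simp cong: measurable_cong)
  qed
  \<comment> \<open>By invariance of the measure, almost every point and its translate both avoid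
    \<open>N\<close>, so equivariance survives.\<close>
  moreover have "AE \<omega> in M. \<Psi> (act \<gamma> \<omega>) = \<sigma> \<gamma> \<omega> ` \<Psi> \<omega>" if "\<gamma> \<in> carrier \<Gamma>" for \<gamma>
    using equivariant[OF that] AE_N AE_act[OF that AE_N]
    by eventually_elim (simp add: \<Psi>_def)
  ultimately have "AE \<omega> in M. \<Psi> \<omega> = UNIV"
    using minimal unfolding minimal_cocycle_def by blast
  with AE_N show ?thesis by eventually_elim (simp add: \<Psi>_def)
qed

lemma semicohomology_AE_homeo_plus:
  assumes \<sigma>1: "measurable_cocycle \<Gamma> M act \<sigma>1" "minimal_cocycle \<Gamma> M act \<sigma>1"
    and \<sigma>2: "measurable_cocycle \<Gamma> M act \<sigma>2" "minimal_cocycle \<Gamma> M act \<sigma>2"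
    and \<phi>: "left_semicohomology \<Gamma> M act \<sigma>1 \<sigma>2 \<phi>"
  shows "AE \<omega> in M. (\<lambda>x. \<phi> (x, \<omega>)) \<in> homeo_plus"
proof -
  have meas: "(\<lambda>\<omega>. \<phi> (x, \<omega>)) \<in> M \<rightarrow>\<^sub>M borel" for x
  proof -
    have "\<phi> \<in> borel \<Otimes>\<^sub>M M \<rightarrow>\<^sub>M borel" using \<phi> by (simp add: left_semicohomology_def)
    moreover have "Pair x \<in> M \<rightarrow>\<^sub>M borel \<Otimes>\<^sub>M M" by (rule measurable_Pair1') simp
    ultimately show ?thesis using measurable_compose by blast
  qed
  have mono: "AE \<omega> in M. nondecreasing_degree_one (\<lambda>x. \<phi> (x, \<omega>))"
    using \<phi> by (simp add: left_semicohomology_def)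
  have intertwine: "AE \<omega> in M. \<exists>h k. homeomorphism UNIV UNIV (\<sigma>1 \<gamma> \<omega>) h \<and>
      homeomorphism UNIV UNIV (\<sigma>2 \<gamma> \<omega>) k \<and>
      \<sigma>1 \<gamma> \<omega> \<circ> (\<lambda>x. \<phi> (x, \<omega>)) = (\<lambda>x. \<phi> (x, act \<gamma> \<omega>)) \<circ> \<sigma>2 \<gamma> \<omega>" if \<gamma>: "\<gamma> \<in> carrier \<Gamma>" for \<gamma>
  proof -
    have "AE \<omega> in M. \<sigma>1 \<gamma> \<omega> \<circ> (\<lambda>x. \<phi> (x, \<omega>)) = (\<lambda>x. \<phi> (x, act \<gamma> \<omega>)) \<circ> \<sigma>2 \<gamma> \<omega>"
      using \<phi> that unfolding left_semicohomology_def by blast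
    then show ?thesis using AE_space
    proof eventually_elim
      case (elim \<omega>)
      obtain h where "homeomorphism UNIV UNIV (\<sigma>1 \<gamma> \<omega>) h"
        using measurable_cocycle_homeo_plus[OF \<sigma>1(1) \<gamma> elim(2)] by (rule homeo_plus_homeomorphism)
      moreover obtain k where "homeomorphism UNIV UNIV (\<sigma>2 \<gamma> \<omega>) k"
        using measurable_cocycle_homeo_plus[OF \<sigma>2(1) \<gamma> elim(2)] by (rule homeo_plus_homeomorphism)
      ultimately show ?case using elim(1) by blast
    qed
  qed
  \<comment> \<open>Monotonicity plays the role of \<open>Q\<close>: it gives non-emptiness and the
    rational criterion for meeting a ball.\<close>
  have "AE \<omega> in M. essential_range (\<lambda>x. \<phi> (x, \<omega>)) = UNIV"
  proof (rule minimal_cocycle_AE_UNIV[OF \<sigma>1(2,1) mono])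
    show "Measurable.pred M (\<lambda>\<omega>. \<exists>n. \<exists>a\<in>\<rat>. \<exists>b\<in>\<rat>. a < b \<and> (\<forall>t\<in>\<rat>. a < t \<and> t < b \<longrightarrow>
      \<phi> (to_circle t, \<omega>) \<in> cball q (r - 1 / real (Suc n))))" for q r
      using meas by (intro pred_intros_countable pred_countable_bounded countable_rat
        pred_intros_logic pred_sets2[where N = borel]) auto
  next
    fix \<gamma> assume "\<gamma> \<in> carrier \<Gamma>"
    from intertwine[OF this]
    show "AE \<omega> in M. essential_range (\<lambda>x. \<phi> (x, act \<gamma> \<omega>)) = \<sigma>1 \<gamma> \<omega> ` essential_range (\<lambda>x. \<phi> (x, \<omega>))"
      by eventually_elim (elim exE conjE, rule essential_range_intertwine)
  qed (auto simp: closed_nonempty_def closed_essential_range essential_range_nonempty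
      essential_range_meets_ball_iff)
  then have dense: "AE \<omega> in M. closure (range (\<lambda>x. \<phi> (x, \<omega>))) = UNIV"
    by eventually_elim (use essential_range_subset_closure in blast)
  \<comment> \<open>Both properties enter the second use of minimality: continuity for the rational
    criterion, density for non-emptiness.\<close>
  then have good: "AE \<omega> in M. continuous_on UNIV (\<lambda>x. \<phi> (x, \<omega>)) \<and> closure (range (\<lambda>x. \<phi> (x, \<omega>))) = UNIV"
    using mono by eventually_elim (auto intro: continuous_nondecreasing_degree_one)
  have "AE \<omega> in M. variation_support (\<lambda>x. \<phi> (x, \<omega>)) = UNIV"
  proof (rule minimal_cocycle_AE_UNIV[OF \<sigma>2(2,1) good])
    show "Measurable.pred M (\<lambda>\<omega>. \<exists>s\<in>\<rat>. \<exists>t\<in>\<rat>. to_circle s \<in> ball q r \<and> to_circle t \<in> ball q r \<and>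
      \<phi> (to_circle s, \<omega>) \<noteq> \<phi> (to_circle t, \<omega>))" for q r
      using meas by (intro pred_countable_bounded countable_rat
        pred_intros_conj1' pred_neq_circle)
  next
    fix \<gamma> assume "\<gamma> \<in> carrier \<Gamma>"
    from intertwine[OF this]
    show "AE \<omega> in M. variation_support (\<lambda>x. \<phi> (x, act \<gamma> \<omega>)) = \<sigma>2 \<gamma> \<omega> ` variation_support (\<lambda>x. \<phi> (x, \<omega>))"
      by eventually_elim (elim exE conjE, rule variation_support_intertwine)
  qed (auto simp: closed_nonempty_def closed_variation_support variation_support_nonempty
      variation_support_meets_ball_iff)
  then show ?thesis using mono dense by eventually_elim (rule homeo_plusI)
qed

end

theorem proposition6p2:
  fixes \<Gamma> :: "('g, 'x) monoid_scheme" and M :: "'w measure" and act :: "'g \<Rightarrow> 'w \<Rightarrow> 'w"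
    and \<sigma>1 \<sigma>2 :: "'g \<Rightarrow> 'w \<Rightarrow> circle \<Rightarrow> circle"
  assumes "finitely_generated_group \<Gamma>"
    and "ergodic_standard_borel_probability_gamma_space \<Gamma> M act"
    and "measurable_cocycle \<Gamma> M act \<sigma>1" "measurable_cocycle \<Gamma> M act \<sigma>2"
    and "minimal_cocycle \<Gamma> M act \<sigma>1" "minimal_cocycle \<Gamma> M act \<sigma>2"
  shows "left_semicohomologous \<Gamma> M act \<sigma>1 \<sigma>2 \<longleftrightarrow> cohomologous \<Gamma> M act \<sigma>1 \<sigma>2"
proof -
  interpret ergodic_standard_borel_probability_gamma_space \<Gamma> M act by fact
  \<comment> \<open>The converse is immediate, since a cohomology is a semicohomology; forwards, the
    same \<phi> serves as witness.\<close>
  show ?thesis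
    unfolding left_semicohomologous_def cohomologous_def
    using semicohomology_AE_homeo_plus[OF assms(3,5,4,6)] by blast
qed

end
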